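(* Assume that $\varphi$ satisfies $(\varphi_1)$, $(\varphi_2)$, $(\varphi_3)$ and that $V$ satisfies $(V_0)$ and $(V_1)$ (all stated in the context). Then the embedding $X\hookrightarrow L_\Phi(\mathbb{R}^N)$ is compact.
   Context: Let $N>2s$ with $N$ a positive integer and $0<s<1$. Let $\varphi:\mathbb{R}\to\mathbb{R}$ be a $C^1$ function such that $\Phi(t)=\int_0^t \tau\varphi(\tau)\,d\tau$ defines an even function $\Phi:\mathbb{R}\to\mathbb{R}$. Conditions on $\varphi$: $(\varphi_1)$ $t\varphi(t)\to 0$ as $t\to 0$ and $t\varphi(t)\to\infty$ as $t\to\infty$; $(\varphi_2)$ $t\varphi(t)$ is strictly increasing in $(0,\infty)$; $(\varphi_3)$ there exist $\ell,m\in(1,N)$ such that $\ell\le \frac{t^2\varphi(t)}{\Phi(t)}\le m<\ell^*$ for all $t>0$, where $\ell^*:=\frac{\ell N}{N-\ell}$. Conditions on the potential $V:\mathbb{R}^N\to\mathbb{R}$ (measurable): $(V_0)$ there is $V_0>0$ with $V(x)\ge V_0$ for all $x\in\mathbb{R}^N$; $(V_1)$ for each $M>0$ the set $\{x\in\mathbb{R}^N: V(x)<M\}$ has finite Lebesgue measure. Spaces: $L_\Phi(\mathbb{R}^N)$ is the set of measurable $u:\mathbb{R}^N\to\mathbb{R}$ with $\int_{\mathbb{R}^N}\Phi(|u|)\,dx<\infty$, with the Luxemburg norm $\|u\|_\Phi=\inf\{\lambda>0:\int_{\mathbb{R}^N}\Phi(|u|/\lambda)\,dx\le1\}$. Put $D_su(x,y)=\frac{u(x)-u(y)}{|x-y|^s}$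 and $d\mu(x,y)=\frac{dx\,dy}{|x-y|^N}$. $W^{s,\Phi}(\mathbb{R}^N)$ is the set of $u\in L_\Phi(\mathbb{R}^N)$ with $\iint_{\mathbb{R}^N\times\mathbb{R}^N}\Phi(|D_su|)\,d\mu<\infty$, with norm $\|u\|_\Phi+[u]_{s,\Phi}$, where $[u]_{s,\Phi}=\inf\{\lambda>0:\iint\Phi(|D_su|/\lambda)\,d\mu\le1\}$. Finally $X=\{u\in W^{s,\Phi}(\mathbb{R}^N):\int_{\mathbb{R}^N} V(x)\Phi(|u|)\,dx<+\infty\}$ with norm $\|u\|=[u]_{s,\Phi}+\|u\|_{V,\Phi}$, where $\|u\|_{V,\Phi}=\inf\{\lambda>0:\int_{\mathbb{R}^N}V(x)\Phi(u/\lambda)\,dx\le1\}$. *)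

theory Defs
  imports "HOL-Analysis.Analysis"
begin

definition Phi :: "(real \<Rightarrow> real) \<Rightarrow> real \<Rightarrow> real" where
  "Phi \<phi> t = (LBINT \<tau>=ereal 0..ereal t. \<tau> * \<phi> \<tau>)"

text \<open>All spaces below are spaces of functions rather than of almost-everywhere classes, so the
  norms are seminorms vanishing on functions that are zero almost everywhere. Integrals of
  the form \<open>\<integral>\<Phi>(\<dots>)\<close> are taken in \<open>[0,\<infinity>]\<close>, as is appropriate for nonnegative \<open>\<Phi>\<close>.\<close>

definition orlicz_space :: "(real \<Rightarrow> real) \<Rightarrow> (real ^ 'n \<Rightarrow> real) set" where
  "orlicz_space \<Phi> = {u \<in> borel_measurable lebesgue.
     (\<integral>\<^sup>+ x. ennreal (\<Phi> \<bar>u x\<bar>) \<partial>lebesgue) < \<infinity>}"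

definition orlicz_norm :: "(real \<Rightarrow> real) \<Rightarrow> (real ^ 'n \<Rightarrow> real) \<Rightarrow> real" where
  "orlicz_norm \<Phi> u = Inf {k. k > 0 \<and>
     (\<integral>\<^sup>+ x. ennreal (\<Phi> (\<bar>u x\<bar> / k)) \<partial>lebesgue) \<le> 1}"

definition holder_quot :: "real \<Rightarrow> (real ^ 'n \<Rightarrow> real) \<Rightarrow> (real ^ 'n) \<times> (real ^ 'n) \<Rightarrow> real" where
  "holder_quot s u = (\<lambda>(x, y). (u x - u y) / norm (x - y) powr s)"

text \<open>The measure \<open>d\<mu> = dx dy / |x - y|^N\<close>. On the diagonal, a null set, the density has the
  value 0 because of division by zero.\<close>

definition frac_measure :: "((real ^ 'n) \<times> (real ^ 'n)) measure" where
  "frac_measure = density (lebesgue \<Otimes>\<^sub>M lebesgue)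
     (\<lambda>(x, y). ennreal (1 / norm (x - y) ^ CARD('n)))"

definition frac_orlicz_sobolev :: "real \<Rightarrow> (real \<Rightarrow> real) \<Rightarrow> (real ^ 'n \<Rightarrow> real) set" where
  "frac_orlicz_sobolev s \<Phi> = {u \<in> orlicz_space \<Phi>.
     (\<integral>\<^sup>+ z. ennreal (\<Phi> \<bar>holder_quot s u z\<bar>) \<partial>frac_measure) < \<infinity>}"

definition frac_seminorm :: "real \<Rightarrow> (real \<Rightarrow> real) \<Rightarrow> (real ^ 'n \<Rightarrow> real) \<Rightarrow> real" where
  "frac_seminorm s \<Phi> u = Inf {k. k > 0 \<and>
     (\<integral>\<^sup>+ z. ennreal (\<Phi> (\<bar>holder_quot s u z\<bar> / k)) \<partial>frac_measure) \<le> 1}"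

definition X_space ::
    "real \<Rightarrow> (real \<Rightarrow> real) \<Rightarrow> (real ^ 'n \<Rightarrow> real) \<Rightarrow> (real ^ 'n \<Rightarrow> real) set" where
  "X_space s \<Phi> V = {u \<in> frac_orlicz_sobolev s \<Phi>.
     (\<integral>\<^sup>+ x. ennreal (V x * \<Phi> \<bar>u x\<bar>) \<partial>lebesgue) < \<infinity>}"

definition weighted_norm ::
    "(real \<Rightarrow> real) \<Rightarrow> (real ^ 'n \<Rightarrow> real) \<Rightarrow> (real ^ 'n \<Rightarrow> real) \<Rightarrow> real" where
  "weighted_norm \<Phi> V u = Inf {k. k > 0 \<and>
     (\<integral>\<^sup>+ x. ennreal (V x * \<Phi> (u x / k)) \<partial>lebesgue) \<le> 1}"

definition X_norm ::
    "real \<Rightarrow> (real \<Rightarrow> real) \<Rightarrow> (real ^ 'n \<Rightarrow> real) \<Rightarrow> (real ^ 'n \<Rightarrow> real) \<Rightarrow> real" where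
  "X_norm s \<Phi> V u = frac_seminorm s \<Phi> u + weighted_norm \<Phi> V u"

text \<open>The inclusion of \<open>A\<close> (with norm \<open>p\<close>) into \<open>B\<close> (with norm \<open>q\<close>) is a bounded operator,
  and every \<open>p\<close>-bounded sequence in \<open>A\<close> has a subsequence that \<open>q\<close>-converges in \<open>B\<close>.\<close>

definition compact_embedding ::
    "('a \<Rightarrow> real) set \<Rightarrow> (('a \<Rightarrow> real) \<Rightarrow> real) \<Rightarrow> ('a \<Rightarrow> real) set \<Rightarrow> (('a \<Rightarrow> real) \<Rightarrow> real) \<Rightarrow> bool" where
  "compact_embedding A p B q \<longleftrightarrow>
     A \<subseteq> B \<and>
     (\<exists>C. \<forall>u\<in>A. q u \<le> C * p u) \<and>
     (\<forall>U :: nat \<Rightarrow> 'a \<Rightarrow> real.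
        (\<forall>n. U n \<in> A) \<and> (\<exists>K. \<forall>n. p (U n) \<le> K) \<longrightarrow>
        (\<exists>u\<in>B. \<exists>r. strict_mono r \<and> (\<lambda>n. q (\<lambda>x. U (r n) x - u x)) \<longlonglongrightarrow> 0))"

end

theory Submission
  imports Defs "HOL-Probability.Probability_Measure" "HOL-Library.Diagonal_Subsequence"
begin

text \<open>The Young function is convex, even and doubling, so norm bounds and norm convergence are
  equivalent to bounds and convergence of modulars. Replace \<open>u\<close> by its averages \<open>P u\<close> over the cells of
  a cubic grid of side \<open>1/k\<close>. By Jensen, the modular of \<open>u - P u\<close> is at most \<open>C k\<^sup>-\<^sup>s\<close> times the fractional
  modular of \<open>u\<close>, and \<open>P u\<close> is bounded in terms of \<open>k\<close> and the modular of \<open>u\<close>. Given a bounded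
  sequence, a diagonal argument makes all cell averages converge along a subsequence. That
  subsequence is Cauchy: where \<open>V \<ge> M\<close> the modular is at most a constant over \<open>M\<close>, and on the set
  \<open>V < M\<close> of finite measure the averages converge by dominated convergence. Completeness
  of the Orlicz space finishes the proof.\<close>

section \<open>Young functions with the doubling property\<close>

text \<open>Convexity controls \<open>F\<close> when its argument shrinks, doubling when it grows.
  For \<open>Phi \<phi>\<close> the constant \<open>D\<close> will be
  \<open>2 powr m\<close>.\<close>

locale doubling_young =
  fixes F :: "real \<Rightarrow> real" and D :: real
  assumes zero [simp]: "F 0 = 0"
    and minus [simp]: "F (- t) = F t"
    and convex: "convex_on UNIV F"
    and pos: "t > 0 \<Longrightarrow> F t > 0"
    and doubling: "F (2 * t) \<le> D * F t"
begin

lemma abs_arg [simp]: "F \<bar>t\<bar> = F t"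
  by (cases "t \<ge> 0") auto

lemma nonneg [simp]: "F t \<ge> 0"
  using pos[of "\<bar>t\<bar>"] by (cases "t = 0") auto

text \<open>Convexity on the segment from 0 to \<open>t\<close>, with
  \<open>F 0 = 0\<close>.\<close>

lemma scale_le: "0 \<le> c \<Longrightarrow> c \<le> 1 \<Longrightarrow> F (c * t) \<le> c * F t"
  using convex_onD[OF convex, of c 0 t] by simp

lemma mono: "\<bar>a\<bar> \<le> \<bar>b\<bar> \<Longrightarrow> F a \<le> F b"
proof (cases "b = 0")
  case False
  assume ab: "\<bar>a\<bar> \<le> \<bar>b\<bar>"
  have "F a = F ((\<bar>a\<bar> / \<bar>b\<bar>) * \<bar>b\<bar>)" using False by simp
  also have "\<dots> \<le> (\<bar>a\<bar> / \<bar>b\<bar>) * F b"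
    using scale_le[of "\<bar>a\<bar> / \<bar>b\<bar>" "\<bar>b\<bar>"] ab False by simp
  also have "\<dots> \<le> 1 * F b" using ab False by (intro mult_right_mono) auto
  finally show ?thesis by simp
qed simp

lemma measurable_F [measurable]: "F \<in> borel_measurable borel"
  using convex_on_continuous[OF open_UNIV convex] by (rule borel_measurable_continuous_onI)

lemma continuous_F: "continuous_on UNIV F"
  using convex_on_continuous[OF open_UNIV convex] .

lemma isCont_F: "isCont F t"
  using continuous_F by (simp add: continuous_on_eq_continuous_at)

lemma D_ge_1: "D \<ge> 1"
proof -
  have "F 1 \<le> F (2 * 1)" by (rule mono) simp
  also have "\<dots> \<le> D * F 1" by (rule doubling)
  finally show ?thesis using pos[of 1] by simp
qed

lemma doubling_power: "F (2 ^ j * t) \<le> D ^ j * F t"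
proof (induction j)
  case (Suc j)
  have "F (2 ^ Suc j * t) \<le> D * F (2 ^ j * t)"
    using doubling[of "2 ^ j * t"] by (simp add: mult.assoc)
  also have "\<dots> \<le> D * (D ^ j * F t)"
    using Suc D_ge_1 by (intro mult_left_mono) auto
  finally show ?case by (simp add: mult.assoc)
qed simp

text \<open>A substitute for the triangle inequality: the sum is at most twice the summand
  \<open>c\<close> of larger modulus, and doubling absorbs the 2.\<close>

lemma add_le: "F (a + b) \<le> D * (F a + F b)"
proof -
  define c where "c = (if \<bar>a\<bar> \<le> \<bar>b\<bar> then b else a)"
  have "F (a + b) \<le> F (2 * c)" by (rule mono) (auto simp: c_def)
  also have "\<dots> \<le> D * F c" by (rule doubling)
  also have "\<dots> \<le> D * (F a + F b)"
    using D_ge_1 by (intro mult_left_mono) (auto simp: c_def)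
  finally show ?thesis .
qed

lemma diff_le: "F (a - b) \<le> D * (F a + F b)"
  using add_le[of a "- b"] by simp

text \<open>Beyond 1, convexity forces at least linear growth,
  \<open>\<bar>t\<bar> * F 1 \<le> F t\<close>. This turns modular bounds into integrability on
  probability spaces and into pointwise bounds.\<close>

lemma abs_le: "\<bar>t\<bar> \<le> 1 + F t / F 1"
proof (cases "\<bar>t\<bar> \<le> 1")
  case True
  then show ?thesis using pos[of 1] by (simp add: add_increasing2)
next
  case False
  have "F 1 = F (inverse \<bar>t\<bar> * \<bar>t\<bar>)" using False by simp
  also have "\<dots> \<le> inverse \<bar>t\<bar> * F \<bar>t\<bar>"
    using False by (intro scale_le) (auto simp: field_simps)
  finally have "\<bar>t\<bar> * F 1 \<le> F t" using False by (simp add: field_simps)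
  then show ?thesis using pos[of 1] by (simp add: field_simps)
qed

lemma jensen:
  assumes "prob_space M" and [measurable]: "f \<in> borel_measurable M"
    and fin: "(\<integral>\<^sup>+x. ennreal (F (f x)) \<partial>M) < \<infinity>"
  shows "integrable M f" and "ennreal (F (\<integral>x. f x \<partial>M)) \<le> (\<integral>\<^sup>+x. ennreal (F (f x)) \<partial>M)"
proof -
  interpret prob_space M by fact
  have iF: "integrable M (\<lambda>x. F (f x))"
    using fin by (intro integrableI_bounded) auto
  have "integrable M (\<lambda>x. 1 + F (f x) / F 1)" using iF by auto
  then show i: "integrable M f"
    by (rule Bochner_Integration.integrable_bound)
       (use abs_le in \<open>auto simp: add_nonneg_nonneg intro!: AE_I2 order_trans[OF abs_le]\<close>)
  have "F (\<integral>x. f x \<partial>M) \<le> (\<integral>x. F (f x) \<partial>M)"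
    by (rule jensens_inequality[of f UNIV]) (use i iF convex in auto)
  then show "ennreal (F (\<integral>x. f x \<partial>M)) \<le> (\<integral>\<^sup>+x. ennreal (F (f x)) \<partial>M)"
    using nn_integral_eq_integral[OF iF] by (simp add: ennreal_leI)
qed

subsection \<open>Modulars and Luxemburg norms\<close>

lemma modular_add_le:
  assumes [measurable]: "f \<in> borel_measurable M" "g \<in> borel_measurable M"
  shows "(\<integral>\<^sup>+x. ennreal (F (f x + g x)) \<partial>M) \<le>
    ennreal D * ((\<integral>\<^sup>+x. ennreal (F (f x)) \<partial>M) + (\<integral>\<^sup>+x. ennreal (F (g x)) \<partial>M))"
proof -
  have "(\<integral>\<^sup>+x. ennreal (F (f x + g x)) \<partial>M) \<le>
      (\<integral>\<^sup>+x. ennreal D * (ennreal (F (f x)) + ennreal (F (g x))) \<partial>M)"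
    using add_le D_ge_1 by (intro nn_integral_mono) (simp flip: ennreal_mult ennreal_plus add: ennreal_leI)
  then show ?thesis by (simp add: nn_integral_cmult nn_integral_add)
qed

lemma modular_diff_le:
  assumes [measurable]: "f \<in> borel_measurable M" "g \<in> borel_measurable M"
  shows "(\<integral>\<^sup>+x. ennreal (F (f x - g x)) \<partial>M) \<le>
    ennreal D * ((\<integral>\<^sup>+x. ennreal (F (f x)) \<partial>M) + (\<integral>\<^sup>+x. ennreal (F (g x)) \<partial>M))"
  using modular_add_le[of f M "\<lambda>x. - g x"] by simp

text \<open>Since \<open>1 / k \<le> 2 ^ j * r\<close>, doubling \<open>j\<close> times passes from
  \<open>r * g x\<close> to \<open>g x / k\<close>. The weight \<open>w\<close> lets one statement
  serve all the norms: \<open>w = V\<close> for the weighted norm, \<open>w = 1\<close> for the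
  other two.\<close>

lemma modular_doubling:
  assumes "w \<in> borel_measurable M" "g \<in> borel_measurable M" and w: "\<And>x. w x \<ge> 0"
    and k: "0 < k" "1 / k \<le> 2 ^ j * r" "0 < r"
  shows "(\<integral>\<^sup>+x. ennreal (w x * F (g x / k)) \<partial>M) \<le>
    ennreal (D ^ j) * (\<integral>\<^sup>+x. ennreal (w x * F (r * g x)) \<partial>M)"
proof -
  note [measurable] = assms(1,2)
  have "F (g x / k) \<le> D ^ j * F (r * g x)" for x
  proof -
    have "\<bar>g x / k\<bar> = \<bar>g x\<bar> * (1 / k)" using k by simp
    also have "\<dots> \<le> \<bar>g x\<bar> * (2 ^ j * r)" by (intro mult_left_mono k) auto
    also have "\<dots> = \<bar>2 ^ j * (r * g x)\<bar>" using k by (simp add: abs_mult)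
    finally have "F (g x / k) \<le> F (2 ^ j * (r * g x))" by (rule mono)
    then show ?thesis using doubling_power[of j "r * g x"] by simp
  qed
  then have "w x * F (g x / k) \<le> D ^ j * (w x * F (r * g x))" for x
    using mult_left_mono[OF _ w[of x], of "F (g x / k)" "D ^ j * F (r * g x)"] by (simp add: ac_simps)
  then have "(\<integral>\<^sup>+x. ennreal (w x * F (g x / k)) \<partial>M) \<le>
      (\<integral>\<^sup>+x. ennreal (D ^ j) * ennreal (w x * F (r * g x)) \<partial>M)"
    using D_ge_1 w by (intro nn_integral_mono) (simp flip: ennreal_mult add: ennreal_leI)
  then show ?thesis by (simp add: nn_integral_cmult)
qed

text \<open>If the modular \<open>I\<close> is finite, \<open>k = 1 + I\<close> is admissible,
  because \<open>F (t / k) \<le> F t / k\<close> for \<open>k \<ge> 1\<close>. A witness matters, as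
  the real \<open>Inf\<close> of the empty set carries no information.\<close>

lemma luxemburg_set_nonempty:
  assumes "w \<in> borel_measurable M" "g \<in> borel_measurable M" and w: "\<And>x. w x \<ge> 0"
    and fin: "(\<integral>\<^sup>+x. ennreal (w x * F (g x)) \<partial>M) < \<infinity>"
  shows "\<exists>k>0. (\<integral>\<^sup>+x. ennreal (w x * F (g x / k)) \<partial>M) \<le> 1"
proof -
  note [measurable] = assms(1,2)
  define I where "I = (\<integral>\<^sup>+x. ennreal (w x * F (g x)) \<partial>M)"
  define k where "k = 1 + enn2real I"
  have k: "k \<ge> 1" by (simp add: k_def)
  have "w x * F (g x / k) \<le> (1 / k) * (w x * F (g x))" for x
    using mult_left_mono[OF scale_le[of "1 / k" "g x"] w[of x]] k by (simp add: ac_simps)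
  then have "(\<integral>\<^sup>+x. ennreal (w x * F (g x / k)) \<partial>M) \<le>
      (\<integral>\<^sup>+x. ennreal (1 / k) * ennreal (w x * F (g x)) \<partial>M)"
    using k w by (intro nn_integral_mono) (simp flip: ennreal_mult add: ennreal_leI)
  also have "\<dots> = ennreal (1 / k) * I" by (simp add: nn_integral_cmult I_def)
  also have "I = ennreal (enn2real I)" using fin by (simp add: I_def)
  also have "ennreal (1 / k) * ennreal (enn2real I) \<le> 1"
  proof -
    have "enn2real I \<le> k" by (simp add: k_def)
    then have "1 / k * enn2real I \<le> 1" using k by (simp add: field_simps)
    then show ?thesis using k by (simp flip: ennreal_mult)
  qed
  finally show ?thesis using k by (intro exI[of _ k]) auto
qed

lemma luxemburg_bdd_below: "bdd_below {k::real. k > 0 \<and> P k}"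
  by (rule bdd_belowI[of _ 0]) auto

lemma luxemburg_nonneg:
  assumes "w \<in> borel_measurable M" "g \<in> borel_measurable M" "\<And>x. w x \<ge> 0"
    and "(\<integral>\<^sup>+x. ennreal (w x * F (g x)) \<partial>M) < \<infinity>"
  shows "0 \<le> Inf {k. k > 0 \<and> (\<integral>\<^sup>+x. ennreal (w x * F (g x / k)) \<partial>M) \<le> 1}"
  using luxemburg_set_nonempty[OF assms] by (intro cInf_greatest) auto

text \<open>The infimum need not be attained, so an admissible \<open>k\<close> is taken below
  \<open>K + 1\<close>. As \<open>k \<le> 2 ^ j\<close>, doubling \<open>j\<close> times removes the
  division by \<open>k\<close>.\<close>

lemma modular_le_of_luxemburg_le:
  assumes "w \<in> borel_measurable M" "g \<in> borel_measurable M" and w: "\<And>x. w x \<ge> 0"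
    and "(\<integral>\<^sup>+x. ennreal (w x * F (g x)) \<partial>M) < \<infinity>"
    and K: "Inf {k. k > 0 \<and> (\<integral>\<^sup>+x. ennreal (w x * F (g x / k)) \<partial>M) \<le> 1} \<le> K"
    and j: "K + 1 \<le> 2 ^ j"
  shows "(\<integral>\<^sup>+x. ennreal (w x * F (g x)) \<partial>M) \<le> ennreal (D ^ j)"
proof -
  let ?S = "{k. k > 0 \<and> (\<integral>\<^sup>+x. ennreal (w x * F (g x / k)) \<partial>M) \<le> 1}"
  have "?S \<noteq> {}" using luxemburg_set_nonempty[OF assms(1-4)] by auto
  moreover have "Inf ?S < K + 1" using K by simp
  ultimately obtain k where k: "k > 0" "(\<integral>\<^sup>+x. ennreal (w x * F (g x / k)) \<partial>M) \<le> 1" "k < K + 1"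
    by (auto simp: cInf_less_iff luxemburg_bdd_below)
  \<comment> \<open>The division by 1 gives the left side the form required by
    \<open>modular_doubling\<close>, with scale \<open>r = 1 / k\<close>.\<close>
  have "(\<integral>\<^sup>+x. ennreal (w x * F (g x / 1)) \<partial>M) \<le>
      ennreal (D ^ j) * (\<integral>\<^sup>+x. ennreal (w x * F (1 / k * g x)) \<partial>M)"
    using k j by (intro modular_doubling assms) (auto simp: field_simps)
  also have "\<dots> \<le> ennreal (D ^ j) * 1" using k(2) by (intro mult_left_mono) auto
  finally show ?thesis by simp
qed

lemma luxemburg_tendsto_0:
  assumes g [measurable]: "\<And>n. g n \<in> borel_measurable M"
    and lim: "(\<lambda>n. \<integral>\<^sup>+x. ennreal (F (g n x)) \<partial>M) \<longlonglongrightarrow> 0"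
  shows "(\<lambda>n. Inf {k. k > 0 \<and> (\<integral>\<^sup>+x. ennreal (F (g n x / k)) \<partial>M) \<le> 1}) \<longlonglongrightarrow> 0"
proof (rule LIMSEQ_I)
  fix e :: real assume e: "e > 0"
  \<comment> \<open>The candidate \<open>e / 2\<close> leaves room for a strict bound by
    \<open>e\<close>. Dividing by it costs at most \<open>D ^ j\<close>, so it is admissible once
    the modular is below \<open>1 / D ^ j\<close>.\<close>
  obtain j where j: "1 / (e / 2) < 2 ^ j" using real_arch_pow[of 2] by auto
  have "\<forall>\<^sub>F n in sequentially. (\<integral>\<^sup>+x. ennreal (F (g n x)) \<partial>M) < ennreal (1 / D ^ j)"
    using D_ge_1 by (intro order_tendstoD(2)[OF lim]) auto
  then obtain N where N: "\<And>n. n \<ge> N \<Longrightarrow> (\<integral>\<^sup>+x. ennreal (F (g n x)) \<partial>M) < ennreal (1 / D ^ j)"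
    by (auto simp: eventually_sequentially)
  show "\<exists>N. \<forall>n\<ge>N. norm (Inf {k. k > 0 \<and> (\<integral>\<^sup>+x. ennreal (F (g n x / k)) \<partial>M) \<le> 1} - 0) < e"
  proof (intro exI allI impI)
    fix n assume n: "n \<ge> N"
    let ?S = "{k. k > 0 \<and> (\<integral>\<^sup>+x. ennreal (F (g n x / k)) \<partial>M) \<le> 1}"
    have "(\<integral>\<^sup>+x. ennreal (F (g n x / (e / 2))) \<partial>M) \<le>
        ennreal (D ^ j) * (\<integral>\<^sup>+x. ennreal (F (g n x)) \<partial>M)"
      using modular_doubling[of "\<lambda>_. 1" M "g n" "e / 2" j 1] e j by simp
    also have "\<dots> \<le> ennreal (D ^ j) * ennreal (1 / D ^ j)"
      using N[OF n] by (intro mult_left_mono) auto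
    also have "\<dots> = 1" using D_ge_1 by (simp flip: ennreal_mult)
    finally have S: "e / 2 \<in> ?S" using e by simp
    have "0 \<le> Inf ?S" using S by (intro cInf_greatest) (blast, auto)
    moreover have "Inf ?S \<le> e / 2" using S luxemburg_bdd_below by (intro cInf_lower)
    ultimately show "norm (Inf ?S - 0) < e" using e by simp
  qed
qed

text \<open>The Riesz-Fischer argument: a rapidly Cauchy subsequence converges almost everywhere,
  and Fatou's lemma upgrades this to convergence in modular.\<close>

lemma modular_complete:
  fixes U :: "nat \<Rightarrow> 'a \<Rightarrow> real"
  assumes [measurable]: "\<And>n. U n \<in> borel_measurable M"
    and cauchy: "\<And>e::real. e > 0 \<Longrightarrow>
      \<exists>N. \<forall>i\<ge>N. \<forall>j\<ge>N. (\<integral>\<^sup>+x. ennreal (F (U i x - U j x)) \<partial>M) \<le> ennreal e"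
  shows "\<exists>r u. strict_mono r \<and> u \<in> borel_measurable M \<and>
      (\<lambda>n. \<integral>\<^sup>+x. ennreal (F (U (r n) x - u x)) \<partial>M) \<longlonglongrightarrow> 0"
proof -
  \<comment> \<open>chosen so that \<open>D ^ j * e j = (1/2) ^ j\<close> is summable\<close>
  define e where "e j = (1 / (2 * D)) ^ j" for j :: nat
  have e: "e j > 0" for j using D_ge_1 by (simp add: e_def)
  have "\<exists>N :: nat \<Rightarrow> nat. \<forall>j. \<forall>i\<ge>N j. \<forall>i'\<ge>N j. (\<integral>\<^sup>+x. ennreal (F (U i x - U i' x)) \<partial>M) \<le> ennreal (e j)"
    using cauchy[OF e] by metis
  then obtain N :: "nat \<Rightarrow> nat" where N: "\<And>j i i'. i \<ge> N j \<Longrightarrow> i' \<ge> N j \<Longrightarrow>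
      (\<integral>\<^sup>+x. ennreal (F (U i x - U i' x)) \<partial>M) \<le> ennreal (e j)" by metis
  \<comment> \<open>\<open>Suc p\<close> makes \<open>r\<close> strictly increasing;
    \<open>N (Suc j)\<close> puts all later terms within \<open>e (Suc j)\<close> of each
    other.\<close>
  define r where "r = rec_nat (N 0) (\<lambda>j p. max (Suc p) (N (Suc j)))"
  have r0: "r 0 = N 0" and rS: "r (Suc j) = max (Suc (r j)) (N (Suc j))" for j
    by (auto simp: r_def)
  have r: "strict_mono r" by (simp add: strict_mono_Suc_iff rS less_max_iff_disj)
  have rN: "r j \<ge> N j" for j by (cases j) (auto simp: r0 rS)
  have close: "(\<integral>\<^sup>+x. ennreal (F (U (r j) x - U (r i) x)) \<partial>M) \<le> ennreal (e j)" if "j \<le> i" for i j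
    using that r rN[of j] by (intro N) (auto simp: strict_mono_less_eq intro: order_trans)
  define d where "d j x = U (r (Suc j)) x - U (r j) x" for j x
  have [measurable]: "d j \<in> borel_measurable M" for j unfolding d_def by simp
  \<comment> \<open>Even after magnification by \<open>2 ^ j\<close> the increments have summable
    modulars. Hence almost everywhere \<open>F (2 ^ j * d j x)\<close> is bounded in
    \<open>j\<close>, and \<open>abs_le\<close> makes \<open>d j x\<close> geometrically
    small.\<close>
  have step: "(\<integral>\<^sup>+x. ennreal (F (2 ^ j * d j x)) \<partial>M) \<le> ennreal ((1/2) ^ j)" for j
  proof -
    have "(\<integral>\<^sup>+x. ennreal (F (2 ^ j * d j x)) \<partial>M) \<le> (\<integral>\<^sup>+x. ennreal (D ^ j) * ennreal (F (d j x)) \<partial>M)"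
      using doubling_power D_ge_1
      by (intro nn_integral_mono) (simp flip: ennreal_mult add: ennreal_leI)
    also have "\<dots> = ennreal (D ^ j) * (\<integral>\<^sup>+x. ennreal (F (U (r j) x - U (r (Suc j)) x)) \<partial>M)"
      using minus[of "d j _"] by (simp add: nn_integral_cmult d_def)
    also have "\<dots> \<le> ennreal (D ^ j) * ennreal (e j)"
      by (intro mult_left_mono close) auto
    also have "\<dots> = ennreal ((1/2) ^ j)"
      using D_ge_1 by (simp flip: ennreal_mult add: e_def power_divide power_mult_distrib field_simps)
    finally show ?thesis .
  qed
  have "(\<integral>\<^sup>+x. (\<Sum>j. ennreal (F (2 ^ j * d j x))) \<partial>M) = (\<Sum>j. \<integral>\<^sup>+x. ennreal (F (2 ^ j * d j x)) \<partial>M)"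
    by (rule nn_integral_suminf) simp
  also have "\<dots> \<le> (\<Sum>j. ennreal ((1/2) ^ j))" by (intro suminf_le step) auto
  also have "\<dots> = ennreal (\<Sum>j. (1/2) ^ j)" by (intro suminf_ennreal2) (auto simp: summable_geometric)
  also have "\<dots> < \<infinity>" by simp
  finally have "AE x in M. (\<Sum>j. ennreal (F (2 ^ j * d j x))) \<noteq> \<infinity>"
    by (intro nn_integral_PInf_AE) auto
  then have conv: "AE x in M. convergent (\<lambda>j. U (r j) x)"
  proof eventually_elim
    case (elim x)
    define S where "S = enn2real (\<Sum>j. ennreal (F (2 ^ j * d j x)))"
    have "ennreal (F (2 ^ j * d j x)) \<le> ennreal S" for j
      using elim sum_le_suminf[of "\<lambda>j. ennreal (F (2 ^ j * d j x))" "{j}"]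
      by (simp add: S_def less_top)
    then have FS: "F (2 ^ j * d j x) \<le> S" for j
      by (simp add: S_def)
    have "\<bar>d j x\<bar> \<le> (1 + S / F 1) * (1/2) ^ j" for j
    proof -
      have "\<bar>2 ^ j * d j x\<bar> \<le> 1 + F (2 ^ j * d j x) / F 1" by (rule abs_le)
      also have "\<dots> \<le> 1 + S / F 1" using FS pos[of 1] by (intro add_mono divide_right_mono) auto
      finally show ?thesis by (simp add: abs_mult power_divide field_simps)
    qed
    then have bound: "norm (d j x) \<le> (1 + S / F 1) * (1/2) ^ j" for j by simp
    have "summable (\<lambda>j. (1 + S / F 1) * (1/2::real) ^ j)"
      by (intro summable_mult summable_geometric) simp
    then have "summable (\<lambda>j. d j x)"
      by (rule summable_comparison_test') (rule bound)
    then have "convergent (\<lambda>n. \<Sum>j<n. d j x)" by (simp add: summable_iff_convergent)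
    moreover have "(\<Sum>j<n. d j x) = U (r n) x - U (r 0) x" for n
      unfolding d_def by (rule sum_lessThan_telescope)
    ultimately show ?case by (simp add: convergent_diff_const_right_iff)
  qed
  \<comment> \<open>Where the sequence diverges, \<open>lim\<close> gives some default value; this
    happens only on a null set, which the integrals below ignore.\<close>
  define u where "u x = lim (\<lambda>j. U (r j) x)" for x
  have [measurable]: "u \<in> borel_measurable M" unfolding u_def by measurable
  have fatou: "(\<integral>\<^sup>+x. ennreal (F (U (r j) x - u x)) \<partial>M) \<le> ennreal (e j)" for j
  proof -
    have "AE x in M. ennreal (F (U (r j) x - u x)) = liminf (\<lambda>i. ennreal (F (U (r j) x - U (r i) x)))"
      using conv
    proof eventually_elim
      case (elim x)
      then have "(\<lambda>i. U (r i) x) \<longlonglongrightarrow> u x" by (simp add: u_def convergent_LIMSEQ_iff)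
      then have "(\<lambda>i. ennreal (F (U (r j) x - U (r i) x))) \<longlonglongrightarrow> ennreal (F (U (r j) x - u x))"
        by (intro tendsto_ennrealI isCont_tendsto_compose[OF isCont_F] tendsto_intros)
      then show ?case by (intro lim_imp_Liminf[symmetric]) auto
    qed
    then have "(\<integral>\<^sup>+x. ennreal (F (U (r j) x - u x)) \<partial>M) =
        (\<integral>\<^sup>+x. liminf (\<lambda>i. ennreal (F (U (r j) x - U (r i) x))) \<partial>M)"
      by (rule nn_integral_cong_AE)
    also have "\<dots> \<le> liminf (\<lambda>i. \<integral>\<^sup>+x. ennreal (F (U (r j) x - U (r i) x)) \<partial>M)"
      by (rule nn_integral_liminf) simp
    also have "\<dots> \<le> limsup (\<lambda>i. \<integral>\<^sup>+x. ennreal (F (U (r j) x - U (r i) x)) \<partial>M)"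
      by (intro Liminf_le_Limsup) auto
    also have "\<dots> \<le> ennreal (e j)"
      by (intro Limsup_bounded) (auto simp: eventually_sequentially intro!: exI[of _ j] close)
    finally show ?thesis .
  qed
  have "e \<longlonglongrightarrow> 0" unfolding e_def using D_ge_1 by (intro LIMSEQ_power_zero) auto
  then have "(\<lambda>j. ennreal (e j)) \<longlonglongrightarrow> 0" by (simp flip: ennreal_0)
  then have "(\<lambda>j. \<integral>\<^sup>+x. ennreal (F (U (r j) x - u x)) \<partial>M) \<longlonglongrightarrow> 0"
    by (rule tendsto_sandwich[OF _ _ tendsto_const, rotated -1]) (auto simp: fatou)
  then show ?thesis using r by (intro exI[of _ r] exI[of _ u]) auto
qed

end

section \<open>Averages over the cells of a cubic grid\<close>

text \<open>Needed for Tonelli on the product of two copies of the completed measure. Boxes with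
  growing integer radius exhaust the space.\<close>

lemma sigma_finite_lebesgue: "sigma_finite_measure (lebesgue :: 'a::euclidean_space measure)"
proof
  show "\<exists>A::'a set set. countable A \<and> A \<subseteq> sets lebesgue \<and> \<Union>A = space lebesgue \<and>
      (\<forall>a\<in>A. emeasure lebesgue a \<noteq> \<infinity>)"
    by (intro exI[of _ "range (\<lambda>n::nat. box (- real n *\<^sub>R One) (real n *\<^sub>R One))"])
       (auto simp: emeasure_lborel_box_eq UN_box_eq_UNIV)
qed

text \<open>Only \<open>k > 0\<close> is meaningful: the cells of index \<open>k = 0\<close> are empty or the whole space.\<close>

definition cell_index :: "nat \<Rightarrow> real ^ 'n \<Rightarrow> int ^ 'n" where
  "cell_index k x = (\<chi> i. \<lfloor>real k * x $ i\<rfloor>)"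

definition cell :: "nat \<Rightarrow> int ^ 'n \<Rightarrow> (real ^ 'n) set" where
  "cell k z = {x. cell_index k x = z}"

text \<open>The Bochner integral is 0 by default if \<open>u\<close> is not integrable on the cell.
  For \<open>k > 0\<close> and measurable \<open>u\<close> of finite modular, \<open>jensen\<close>
  rules this out.\<close>

definition cell_avg :: "nat \<Rightarrow> (real ^ 'n \<Rightarrow> real) \<Rightarrow> int ^ 'n \<Rightarrow> real" where
  "cell_avg k u z = (\<integral>y. u y \<partial>uniform_measure lebesgue (cell k z))"

lemma mem_cell: "x \<in> cell k z \<longleftrightarrow> (\<forall>i. of_int (z $ i) \<le> real k * x $ i \<and> real k * x $ i < of_int (z $ i) + 1)"
  by (simp add: cell_def cell_index_def vec_eq_iff floor_eq_iff)

lemma sets_cell [measurable]: "cell k z \<in> sets lebesgue"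
proof -
  have "cell k z = (\<Inter>i. {x. of_int (z $ i) \<le> real k * x $ i \<and> real k * x $ i < of_int (z $ i) + 1})"
    by (auto simp: mem_cell)
  also have "\<dots> \<in> sets borel" by measurable
  finally show ?thesis by simp
qed

text \<open>There are countably many indices, so preimages of points suffice. With the discrete
  sigma-algebra on the target, every function of the index becomes measurable.\<close>

lemma measurable_cell_index [measurable]:
  "(cell_index k :: real ^ 'n \<Rightarrow> _) \<in> lebesgue \<rightarrow>\<^sub>M count_space UNIV"
proof -
  have "cell_index k -` {z} \<in> sets lebesgue" for z :: "int ^ 'n"
    using sets_cell[of k z] by (simp add: cell_def vimage_def)
  then show ?thesis by (simp add: measurable_count_space_eq2_countable)
qed

text \<open>The half-open cell is squeezed between an open and a closed box of equal volume, which
  yields its measure.\<close>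

lemma cell_between_boxes:
  assumes "k > 0"
  shows "box (\<chi> i. of_int (z $ i) / real k) (\<chi> i. (of_int (z $ i) + 1) / real k) \<subseteq> cell k z"
    and "cell k z \<subseteq> cbox (\<chi> i. of_int (z $ i) / real k) (\<chi> i. (of_int (z $ i) + 1) / real k)"
  using assms by (auto simp: mem_cell mem_box_cart field_simps less_imp_le)

lemma emeasure_cell:
  fixes z :: "int ^ 'n"
  assumes k: "k > 0"
  shows "emeasure lebesgue (cell k z) = ennreal (1 / real k ^ CARD('n))"
proof (rule antisym)
  define a b :: "real ^ 'n" where "a = (\<chi> i. of_int (z $ i) / real k)"
    and "b = (\<chi> i. (of_int (z $ i) + 1) / real k)"
  have ne: "cbox a b \<noteq> {}" using k
    by (auto simp: a_def b_def interval_ne_empty_cart divide_right_mono)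
  have "measure lborel (cbox a b) = (\<Prod>i\<in>(UNIV :: 'n set). 1 / real k)"
    unfolding content_cbox_cart[OF ne] using k by (simp add: a_def b_def diff_divide_distrib[symmetric])
  then have c: "measure lborel (cbox a b) = 1 / real k ^ CARD('n)" by (simp add: power_divide)
  then have cbox: "emeasure lborel (cbox a b) = ennreal (1 / real k ^ CARD('n))"
    using emeasure_eq_ennreal_measure[of lborel "cbox a b"] emeasure_lborel_cbox_finite[of a b]
    by simp
  then have box: "emeasure lborel (box a b) = ennreal (1 / real k ^ CARD('n))"
    by (simp only: emeasure_lborel_box_eq emeasure_lborel_cbox_eq)
  have "emeasure lebesgue (cell k z) \<le> emeasure lebesgue (cbox a b)"
    using cell_between_boxes(2)[OF k] unfolding a_def b_def by (intro emeasure_mono) auto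
  then show "emeasure lebesgue (cell k z) \<le> ennreal (1 / real k ^ CARD('n))"
    by (simp add: cbox)
  have "emeasure lebesgue (box a b) \<le> emeasure lebesgue (cell k z)"
    using cell_between_boxes(1)[OF k] unfolding a_def b_def by (intro emeasure_mono) auto
  then show "ennreal (1 / real k ^ CARD('n)) \<le> emeasure lebesgue (cell k z)"
    by (simp add: box)
qed

text \<open>Each of the N coordinates differs by at most \<open>1 / k\<close>, and the Euclidean
  norm is at most the sum of the coordinate moduli.\<close>

lemma norm_diff_cell_le:
  fixes x y :: "real ^ 'n"
  assumes "k > 0" "x \<in> cell k z" "y \<in> cell k z"
  shows "norm (x - y) \<le> real CARD('n) / real k"
proof -
  have "\<bar>(x - y) $ i\<bar> \<le> 1 / real k" for i
  proof -
    have "real k * \<bar>x $ i - y $ i\<bar> = \<bar>real k * x $ i - real k * y $ i\<bar>"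
      by (simp add: abs_mult flip: right_diff_distrib)
    also have "\<dots> \<le> 1" using assms(2,3) unfolding mem_cell by (smt (verit))
    finally show ?thesis using assms(1) by (simp add: field_simps)
  qed
  then have "(\<Sum>i\<in>UNIV. \<bar>(x - y) $ i\<bar>) \<le> (\<Sum>i\<in>(UNIV :: 'n set). 1 / real k)" by (intro sum_mono)
  with norm_le_l1_cart[of "x - y"] show ?thesis by simp
qed

lemma prob_space_cell: "k > 0 \<Longrightarrow> prob_space (uniform_measure lebesgue (cell k z))"
  by (intro prob_space_uniform_measure) (auto simp: emeasure_cell simp del: emeasure_completion)

lemma nn_integral_cell:
  fixes z :: "int ^ 'n"
  assumes "k > 0" "f \<in> borel_measurable lebesgue"
  shows "(\<integral>\<^sup>+y. f y \<partial>uniform_measure lebesgue (cell k z)) =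
    ennreal (real k ^ CARD('n)) * (\<integral>\<^sup>+y. f y * indicator (cell k z) y \<partial>lebesgue)"
  using assms by (simp add: nn_integral_uniform_measure emeasure_cell divide_ennreal_def
      inverse_ennreal mult.commute del: emeasure_completion)

lemma measurable_cell_avg [measurable]: "(\<lambda>x. cell_avg k u (cell_index k x)) \<in> borel_measurable lebesgue"
  by (rule measurable_compose[OF measurable_cell_index]) simp

text \<open>The identity is measurable from the completed to the Borel sigma-algebra. Composing it
  with the projections makes Borel functions of \<open>x - y\<close> measurable on the
  product.\<close>

lemma measurable_projections_lebesgue_borel [measurable]:
  "fst \<in> (lebesgue \<Otimes>\<^sub>M lebesgue :: ('a::euclidean_space \<times> 'a) measure) \<rightarrow>\<^sub>M borel"
  "snd \<in> (lebesgue \<Otimes>\<^sub>M lebesgue :: ('a::euclidean_space \<times> 'a) measure) \<rightarrow>\<^sub>M borel"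
proof -
  have "(\<lambda>x::'a. x) \<in> lebesgue \<rightarrow>\<^sub>M borel"
    by (rule measurable_completion) simp
  then show "fst \<in> (lebesgue \<Otimes>\<^sub>M lebesgue :: ('a \<times> 'a) measure) \<rightarrow>\<^sub>M borel"
    "snd \<in> (lebesgue \<Otimes>\<^sub>M lebesgue :: ('a \<times> 'a) measure) \<rightarrow>\<^sub>M borel"
    using measurable_compose[OF measurable_fst] measurable_compose[OF measurable_snd] by force+
qed

lemma measurable_holder_quot [measurable]:
  fixes u :: "real ^ 'n \<Rightarrow> real"
  assumes [measurable]: "u \<in> borel_measurable lebesgue"
  shows "holder_quot s u \<in> borel_measurable (lebesgue \<Otimes>\<^sub>M lebesgue)"
  unfolding holder_quot_def case_prod_beta
  by measurable

lemma measurable_frac_density [measurable]: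
  "(\<lambda>(x, y). ennreal (1 / norm (x - y) ^ CARD('n)))
    \<in> borel_measurable (lebesgue \<Otimes>\<^sub>M lebesgue :: ((real^'n) \<times> (real^'n)) measure)"
  unfolding case_prod_beta
  by measurable

lemma sets_frac_measure [measurable_cong]: "sets frac_measure = sets (lebesgue \<Otimes>\<^sub>M lebesgue)"
  by (simp add: frac_measure_def)

section \<open>Size and approximation error of cell averages\<close>

context doubling_young
begin

text \<open>Jensen bounds \<open>F\<close> of the average by \<open>real k ^ CARD('n) * A\<close>,
  the power being the reciprocal volume of a cell; \<open>abs_le\<close> then bounds the average.
  The bound is uniform in \<open>z\<close> and in all \<open>u\<close> of modular at most
  \<open>A\<close>, as the diagonal argument and dominated convergence require.\<close>

lemma cell_avg_bound:
  fixes u :: "real ^ 'n \<Rightarrow> real"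
  assumes k: "k > 0" and [measurable]: "u \<in> borel_measurable lebesgue"
    and A: "(\<integral>\<^sup>+x. ennreal (F (u x)) \<partial>lebesgue) \<le> ennreal A" "A \<ge> 0"
  shows "\<bar>cell_avg k u z\<bar> \<le> 1 + real k ^ CARD('n) * A / F 1"
proof -
  have "(\<integral>\<^sup>+y. ennreal (F (u y)) \<partial>uniform_measure lebesgue (cell k z)) =
      ennreal (real k ^ CARD('n)) * (\<integral>\<^sup>+y. ennreal (F (u y)) * indicator (cell k z) y \<partial>lebesgue)"
    by (rule nn_integral_cell[OF k]) simp
  also have "\<dots> \<le> ennreal (real k ^ CARD('n)) * (\<integral>\<^sup>+y. ennreal (F (u y)) \<partial>lebesgue)"
    by (intro mult_left_mono nn_integral_mono) (auto simp: indicator_def)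
  also have "\<dots> \<le> ennreal (real k ^ CARD('n)) * ennreal A" by (intro mult_left_mono A) auto
  finally have le: "(\<integral>\<^sup>+y. ennreal (F (u y)) \<partial>uniform_measure lebesgue (cell k z)) \<le>
      ennreal (real k ^ CARD('n) * A)"
    using A(2) by (simp add: ennreal_mult)
  then have "(\<integral>\<^sup>+y. ennreal (F (u y)) \<partial>uniform_measure lebesgue (cell k z)) < \<infinity>"
    by (rule le_less_trans) simp
  then have "ennreal (F (cell_avg k u z)) \<le> (\<integral>\<^sup>+y. ennreal (F (u y)) \<partial>uniform_measure lebesgue (cell k z))"
    unfolding cell_avg_def by (intro jensen prob_space_cell k) auto
  also note le
  finally have "F (cell_avg k u z) \<le> real k ^ CARD('n) * A" using A(2) by simp
  then have "1 + F (cell_avg k u z) / F 1 \<le> 1 + real k ^ CARD('n) * A / F 1"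
    using pos[of 1] by (intro add_mono divide_right_mono) auto
  with abs_le show ?thesis by (rule order_trans)
qed

text \<open>Points of a cell have distance at most \<open>N/k\<close>, so the normalising factor \<open>k^N\<close> of the average is at
  most \<open>N^N / |x - y|^N\<close>; after Jensen, the average over the cell is dominated by the fractional
  modular. Convexity turns the factor \<open>|x - y|^s\<close> into the decay in \<open>k\<close>.\<close>

lemma cell_avg_approx:
  fixes u :: "real ^ 'n \<Rightarrow> real"
  assumes k: "k \<ge> CARD('n)" and s: "s > 0" and [measurable]: "u \<in> borel_measurable lebesgue"
    and fin: "(\<integral>\<^sup>+x. ennreal (F (u x)) \<partial>lebesgue) < \<infinity>"
  shows "(\<integral>\<^sup>+x. ennreal (F (u x - cell_avg k u (cell_index k x))) \<partial>lebesgue) \<le>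
    ennreal (real CARD('n) ^ CARD('n) * (real CARD('n) / real k) powr s) *
    (\<integral>\<^sup>+z. ennreal (F (holder_quot s u z)) \<partial>frac_measure)"
proof -
  let ?N = "CARD('n)"
  have N: "?N > 0" by simp
  with k have k0: "k > 0" by linarith
  define C where "C = real ?N ^ ?N * (real ?N / real k) powr s"
  have C: "C \<ge> 0" by (simp add: C_def)
  \<comment> \<open>\<open>scale_le\<close> will be applied with the factor \<open>t powr s\<close>,
    which must not exceed 1; this is where \<open>k \<ge> CARD('n)\<close> enters.\<close>
  have "real ?N / real k \<le> 1" using k k0 by (simp add: field_simps)
  then have small: "(real ?N / real k) powr s \<le> 1" using s k0 by (simp add: powr_le1)
  have pointwise: "ennreal (real k ^ ?N) * (ennreal (F (u x - u y)) * indicator (cell k (cell_index k x)) y) \<le>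
      ennreal C * (ennreal (1 / norm (x - y) ^ ?N) * ennreal (F (holder_quot s u (x, y))))" for x y
  \<comment> \<open>Off the cell the indicator vanishes, and for \<open>x = y\<close> the left side
    is \<open>F 0 = 0\<close>, so only distinct points of one cell matter.\<close>
  proof (cases "y \<in> cell k (cell_index k x) \<and> x \<noteq> y")
    case True
    define t where "t = norm (x - y)"
    have t: "t > 0" using True by (simp add: t_def)
    have "x \<in> cell k (cell_index k x)" by (simp add: cell_def)
    then have tle: "t \<le> real ?N / real k"
      using True norm_diff_cell_le[OF k0, of x _ y] by (simp add: t_def)
    have ts: "t powr s \<le> (real ?N / real k) powr s" using t tle s by (intro powr_mono2) auto
    have "F (u x - u y) = F (t powr s * holder_quot s u (x, y))"
      using t by (simp add: holder_quot_def t_def)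
    also have "\<dots> \<le> t powr s * F (holder_quot s u (x, y))"
      using ts small by (intro scale_le) auto
    also have "\<dots> \<le> (real ?N / real k) powr s * F (holder_quot s u (x, y))"
      using ts by (intro mult_right_mono) auto
    finally have 1: "F (u x - u y) \<le> (real ?N / real k) powr s * F (holder_quot s u (x, y))" .
    have "real k * t \<le> real ?N" using tle k0 by (simp add: field_simps)
    then have "(real k * t) ^ ?N \<le> real ?N ^ ?N" using t by (intro power_mono) auto
    then have 2: "real k ^ ?N \<le> real ?N ^ ?N * (1 / t ^ ?N)"
      using t by (simp add: power_mult_distrib field_simps)
    have "real k ^ ?N * F (u x - u y) \<le>
        (real ?N ^ ?N * (1 / t ^ ?N)) * ((real ?N / real k) powr s * F (holder_quot s u (x, y)))"
      using 1 2 t by (intro mult_mono) auto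
    also have "\<dots> = C * (1 / t ^ ?N * F (holder_quot s u (x, y)))" by (simp add: C_def)
    finally show ?thesis
      using True C t by (simp flip: ennreal_mult add: t_def ennreal_leI)
  qed auto
  have "(\<integral>\<^sup>+x. ennreal (F (u x - cell_avg k u (cell_index k x))) \<partial>lebesgue) \<le>
      (\<integral>\<^sup>+x. \<integral>\<^sup>+y. ennreal C * (ennreal (1 / norm (x - y) ^ ?N) *
        ennreal (F (holder_quot s u (x, y)))) \<partial>lebesgue \<partial>lebesgue)"
  proof (rule nn_integral_mono)
    fix x :: "real ^ 'n"
    let ?Q = "cell k (cell_index k x)"
    interpret prob_space "uniform_measure lebesgue ?Q" by (rule prob_space_cell[OF k0])
    have cell_fin: "(\<integral>\<^sup>+y. ennreal (F (u y)) \<partial>uniform_measure lebesgue ?Q) < \<infinity>"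
    proof -
      have "(\<integral>\<^sup>+y. ennreal (F (u y)) * indicator ?Q y \<partial>lebesgue) \<le> (\<integral>\<^sup>+y. ennreal (F (u y)) \<partial>lebesgue)"
        by (intro nn_integral_mono) (auto simp: indicator_def)
      then have "(\<integral>\<^sup>+y. ennreal (F (u y)) * indicator ?Q y \<partial>lebesgue) < \<infinity>"
        using fin by (rule le_less_trans)
      then show ?thesis by (simp add: nn_integral_cell[OF k0] ennreal_mult_less_top)
    qed
    have int_u: "integrable (uniform_measure lebesgue ?Q) u"
      using cell_fin by (intro jensen prob_space_axioms) auto
    \<comment> \<open>Jensen needs a finite modular for \<open>u x - u y\<close> as a function of
      \<open>y\<close>; on the probability measure of the cell the constant \<open>F (u x)\<close>
      contributes a finite amount.\<close>
    have "(\<integral>\<^sup>+y. ennreal (F (u x - u y)) \<partial>uniform_measure lebesgue ?Q) \<le>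
        ennreal D * ((\<integral>\<^sup>+y. ennreal (F (u x)) \<partial>uniform_measure lebesgue ?Q) +
          (\<integral>\<^sup>+y. ennreal (F (u y)) \<partial>uniform_measure lebesgue ?Q))"
      by (rule modular_diff_le) auto
    also have "\<dots> < \<infinity>" using cell_fin using emeasure_space_1 by (simp add: ennreal_mult_less_top del: emeasure_uniform_measure)
    finally have fin': "(\<integral>\<^sup>+y. ennreal (F (u x - u y)) \<partial>uniform_measure lebesgue ?Q) < \<infinity>" .
    have "u x - cell_avg k u (cell_index k x) = (\<integral>y. u x - u y \<partial>uniform_measure lebesgue ?Q)"
      using int_u prob_space by (simp add: cell_avg_def)
    then have "ennreal (F (u x - cell_avg k u (cell_index k x))) \<le>
        (\<integral>\<^sup>+y. ennreal (F (u x - u y)) \<partial>uniform_measure lebesgue ?Q)"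
      using fin' by (simp only:) (intro jensen prob_space_axioms, auto)
    also have "\<dots> = (\<integral>\<^sup>+y. ennreal (real k ^ ?N) * (ennreal (F (u x - u y)) * indicator ?Q y) \<partial>lebesgue)"
      by (simp add: nn_integral_cell[OF k0] nn_integral_cmult)
    also have "\<dots> \<le> (\<integral>\<^sup>+y. ennreal C * (ennreal (1 / norm (x - y) ^ ?N) *
        ennreal (F (holder_quot s u (x, y)))) \<partial>lebesgue)"
      by (intro nn_integral_mono pointwise)
    finally show "ennreal (F (u x - cell_avg k u (cell_index k x))) \<le> \<dots>" .
  qed
  \<comment> \<open>Tonelli merges the two integrals, and the kernel is the density of
    \<open>frac_measure\<close>.\<close>
  also have "\<dots> = (\<integral>\<^sup>+z. ennreal C * ((case z of (x, y) \<Rightarrow> ennreal (1 / norm (x - y) ^ ?N)) *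
        ennreal (F (holder_quot s u z))) \<partial>(lebesgue \<Otimes>\<^sub>M lebesgue))"
    by (subst sigma_finite_measure.nn_integral_fst[OF sigma_finite_lebesgue, symmetric]) simp_all
  also have "\<dots> = ennreal C * (\<integral>\<^sup>+z. ennreal (F (holder_quot s u z)) \<partial>frac_measure)"
    by (simp add: nn_integral_cmult nn_integral_density frac_measure_def)
  finally show ?thesis unfolding C_def .
qed

end

section \<open>Diagonal extraction of a subsequence\<close>

lemma bounded_countable_convergent_subsequence:
  fixes f :: "nat \<Rightarrow> 'a::countable \<Rightarrow> real"
  assumes bdd: "\<And>i. \<exists>B. \<forall>n. \<bar>f n i\<bar> \<le> B"
  shows "\<exists>r. strict_mono r \<and> (\<forall>i. convergent (\<lambda>n. f (r n) i))"
proof -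
  define P where "P i s \<longleftrightarrow> convergent (\<lambda>n. f (s n) (from_nat i))" for i and s :: "nat \<Rightarrow> nat"
  interpret subseqs P
  proof
    fix i and s :: "nat \<Rightarrow> nat"
    obtain B where "\<And>n. \<bar>f n (from_nat i)\<bar> \<le> B" using bdd by metis
    then have "bounded (range (\<lambda>n. f (s n) (from_nat i)))"
      by (intro boundedI[of _ B]) auto
    then obtain l r where "strict_mono r" "((\<lambda>n. f (s n) (from_nat i)) \<circ> r) \<longlonglongrightarrow> l"
      using bounded_imp_convergent_subsequence by blast
    then show "\<exists>r'. strict_mono r' \<and> P i (s \<circ> r')"
      by (auto simp: P_def o_def convergent_def)
  qed
  \<comment> \<open>The diagonal sequence refines the \<open>i\<close>-th subsequence only from
    position \<open>Suc i\<close> on; the initial segment does not affect convergence.\<close>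
  have "P i (diagseq \<circ> ((+) (Suc i)))" for i
    by (rule diagseq_holds) (auto simp: P_def o_def dest: convergent_subseq_convergent)
  then have "convergent (\<lambda>n. f (diagseq (Suc (i + n))) (from_nat i))" for i
    by (simp add: P_def o_def)
  then have "convergent (\<lambda>n. f (diagseq n) (from_nat i))" for i
    using convergent_ignore_initial_segment[of "\<lambda>n. f (diagseq n) (from_nat i)" "Suc i"]
    by (simp add: add.commute[of _ i])
  from this[of "to_nat i" for i :: 'a] have "convergent (\<lambda>n. f (diagseq n) i)" for i by simp
  then show ?thesis using subseq_diagseq by blast
qed

section \<open>Compactness of the embedding\<close>

context doubling_young
begin

lemma abs_divide_arg [simp]: "F (\<bar>t\<bar> / k) = F (t / k)"
  using abs_arg[of "\<bar>t\<bar> / k"] abs_arg[of "t / k"] by simp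

lemma orlicz_space_iff:
  "u \<in> orlicz_space F \<longleftrightarrow> u \<in> borel_measurable lebesgue \<and> (\<integral>\<^sup>+x. ennreal (F (u x)) \<partial>lebesgue) < \<infinity>"
  by (simp add: orlicz_space_def)

lemma X_space_iff:
  "u \<in> X_space s F V \<longleftrightarrow> u \<in> borel_measurable lebesgue \<and>
    (\<integral>\<^sup>+x. ennreal (F (u x)) \<partial>lebesgue) < \<infinity> \<and>
    (\<integral>\<^sup>+z. ennreal (F (holder_quot s u z)) \<partial>frac_measure) < \<infinity> \<and>
    (\<integral>\<^sup>+x. ennreal (V x * F (u x)) \<partial>lebesgue) < \<infinity>"
  by (auto simp: X_space_def frac_orlicz_sobolev_def orlicz_space_iff)

text \<open>Nonnegativity of both summands of \<open>X_norm\<close> is what lets a bound on the sum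
  pass to each of them.\<close>

lemma frac_seminorm_nonneg:
  assumes "u \<in> borel_measurable lebesgue"
    and "(\<integral>\<^sup>+z. ennreal (F (holder_quot s u z)) \<partial>frac_measure) < \<infinity>"
  shows "0 \<le> frac_seminorm s F u"
proof -
  have "holder_quot s u \<in> borel_measurable frac_measure"
    using assms(1) by measurable
  then show ?thesis
    using luxemburg_nonneg[of "\<lambda>_. 1" frac_measure "holder_quot s u"] assms(2)
    by (simp add: frac_seminorm_def)
qed

lemma weighted_norm_nonneg:
  assumes "u \<in> borel_measurable lebesgue" "V \<in> borel_measurable lebesgue" "\<And>x. V x \<ge> 0"
    and "(\<integral>\<^sup>+x. ennreal (V x * F (u x)) \<partial>lebesgue) < \<infinity>"
  shows "0 \<le> weighted_norm F V u"
  using luxemburg_nonneg[of V lebesgue u] assms by (simp add: weighted_norm_def)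

text \<open>If \<open>k\<close> is admissible for the weighted norm, then \<open>k / c\<close> is
  admissible for the Orlicz norm: \<open>F (c * t) \<le> c * F t \<le> V x * F t\<close>.\<close>

lemma orlicz_norm_le_weighted_norm:
  assumes [measurable]: "u \<in> borel_measurable lebesgue" "V \<in> borel_measurable lebesgue"
    and V: "0 < c" "c \<le> 1" "\<And>x. V x \<ge> c"
    and fin: "(\<integral>\<^sup>+x. ennreal (V x * F (u x)) \<partial>lebesgue) < \<infinity>"
  shows "orlicz_norm F u \<le> 1 / c * weighted_norm F V u"
proof -
  have Vnn: "V x \<ge> 0" for x using V(1) V(3)[of x] by linarith
  have "c * orlicz_norm F u \<le> k"
    if k: "k > 0" "(\<integral>\<^sup>+x. ennreal (V x * F (u x / k)) \<partial>lebesgue) \<le> 1" for k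
  proof -
    have "F (u x / (k / c)) \<le> V x * F (u x / k)" for x
    proof -
      have "F (u x / (k / c)) = F (c * (u x / k))" by (simp add: ac_simps)
      also have "\<dots> \<le> c * F (u x / k)" using V by (intro scale_le) auto
      also have "\<dots> \<le> V x * F (u x / k)" using V by (intro mult_right_mono) auto
      finally show ?thesis .
    qed
    then have "(\<integral>\<^sup>+x. ennreal (F (u x / (k / c))) \<partial>lebesgue) \<le>
        (\<integral>\<^sup>+x. ennreal (V x * F (u x / k)) \<partial>lebesgue)"
      by (intro nn_integral_mono ennreal_leI)
    also note k(2)
    finally have "orlicz_norm F u \<le> k / c"
      unfolding orlicz_norm_def using k V by (intro cInf_lower luxemburg_bdd_below) auto
    then show ?thesis using V by (simp add: field_simps)
  qed
  then have "c * orlicz_norm F u \<le> weighted_norm F V u"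
    unfolding weighted_norm_def using luxemburg_set_nonempty[OF assms(2,1) Vnn fin]
    by (intro cInf_greatest) auto
  then show ?thesis using V by (simp add: field_simps)
qed

lemma X_bounded_imp_modular_bounded:
  assumes V: "V \<in> borel_measurable lebesgue" "\<And>x. V x \<ge> 0"
    and U: "\<And>n. U n \<in> X_space s F V" and K: "\<And>n. X_norm s F V (U n) \<le> K"
  shows "\<exists>A>0. \<forall>n. (\<integral>\<^sup>+z. ennreal (F (holder_quot s (U n) z)) \<partial>frac_measure) \<le> ennreal A \<and>
    (\<integral>\<^sup>+x. ennreal (V x * F (U n x)) \<partial>lebesgue) \<le> ennreal A"
proof -
  obtain j where "K + 1 < 2 ^ j" using real_arch_pow[of 2] by auto
  then have j: "K + 1 \<le> 2 ^ j" by simp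
  have "(\<integral>\<^sup>+z. ennreal (F (holder_quot s (U n) z)) \<partial>frac_measure) \<le> ennreal (D ^ j) \<and>
    (\<integral>\<^sup>+x. ennreal (V x * F (U n x)) \<partial>lebesgue) \<le> ennreal (D ^ j)" for n
  proof -
    have u: "U n \<in> borel_measurable lebesgue"
      "(\<integral>\<^sup>+z. ennreal (F (holder_quot s (U n) z)) \<partial>frac_measure) < \<infinity>"
      "(\<integral>\<^sup>+x. ennreal (V x * F (U n x)) \<partial>lebesgue) < \<infinity>"
      using U[of n] by (auto simp: X_space_iff)
    have [measurable]: "holder_quot s (U n) \<in> borel_measurable frac_measure"
      using u(1) by measurable
    have "frac_seminorm s F (U n) \<le> K" "weighted_norm F V (U n) \<le> K"
      using K[of n] frac_seminorm_nonneg[OF u(1,2)] weighted_norm_nonneg[OF u(1) V u(3)]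
      by (auto simp: X_norm_def)
    then show ?thesis
      using modular_le_of_luxemburg_le[of "\<lambda>_. 1" frac_measure "holder_quot s (U n)", OF _ _ _ _ _ j]
        modular_le_of_luxemburg_le[of V lebesgue "U n", OF V(1) u(1) V(2) u(3) _ j] u(2)
      by (simp add: frac_seminorm_def weighted_norm_def)
  qed
  then show ?thesis using D_ge_1 by (intro exI[of _ "D ^ j"]) auto
qed

lemma modular_le_of_weighted_modular_le:
  assumes [measurable]: "u \<in> borel_measurable M" "w \<in> borel_measurable M"
    and w: "c > 0" "\<And>x. w x \<ge> c" and A: "A \<ge> 0"
    and le: "(\<integral>\<^sup>+x. ennreal (w x * F (u x)) \<partial>M) \<le> ennreal A"
  shows "(\<integral>\<^sup>+x. ennreal (F (u x)) \<partial>M) \<le> ennreal (A / c)"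
proof -
  have "F (u x) \<le> 1 / c * (w x * F (u x))" for x
    using mult_right_mono[OF w(2)[of x] nonneg[of "u x"]] w(1) by (simp add: field_simps)
  then have "(\<integral>\<^sup>+x. ennreal (F (u x)) \<partial>M) \<le> (\<integral>\<^sup>+x. ennreal (1 / c) * ennreal (w x * F (u x)) \<partial>M)"
    using w(1) by (intro nn_integral_mono) (simp flip: ennreal_mult' add: ennreal_leI)
  also have "\<dots> = ennreal (1 / c) * (\<integral>\<^sup>+x. ennreal (w x * F (u x)) \<partial>M)"
    by (simp add: nn_integral_cmult)
  also have "\<dots> \<le> ennreal (1 / c) * ennreal A" by (intro mult_left_mono le) auto
  finally show ?thesis using w(1) A by (simp flip: ennreal_mult)
qed

text \<open>The error \<open>e\<close> is split into six parts \<open>e / 6\<close>, three for each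
  of the two functions: the region where \<open>V\<close> is large, the distance to the cell
  averages, and the distance of these averages to their limit \<open>g\<close>. Writing
  \<open>Suc k\<close> in \<open>conv\<close> avoids the degenerate grid.\<close>

lemma X_bounded_modular_Cauchy:
  fixes U :: "nat \<Rightarrow> real ^ 'n \<Rightarrow> real"
  assumes s: "s > 0"
    and V [measurable]: "V \<in> borel_measurable lebesgue" and V0: "V0 > 0" "\<And>x. V x \<ge> V0"
    and V1: "\<And>M. M > 0 \<Longrightarrow> emeasure lebesgue {x. V x < M} < \<infinity>"
    and meas [measurable]: "\<And>n. U n \<in> borel_measurable lebesgue"
    and A: "A > 0"
    and frac: "\<And>n. (\<integral>\<^sup>+z. ennreal (F (holder_quot s (U n) z)) \<partial>frac_measure) \<le> ennreal A"
    and pot: "\<And>n. (\<integral>\<^sup>+x. ennreal (V x * F (U n x)) \<partial>lebesgue) \<le> ennreal A"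
    and conv: "\<And>k z. convergent (\<lambda>n. cell_avg (Suc k) (U n) z)"
    and e: "(e::real) > 0"
  shows "\<exists>N. \<forall>i\<ge>N. \<forall>j\<ge>N. (\<integral>\<^sup>+x. ennreal (F (U i x - U j x)) \<partial>lebesgue) \<le> ennreal e"
proof -
  note mass = modular_le_of_weighted_modular_le[OF meas V V0 less_imp_le[OF A] pot]
  \<comment> \<open>Chosen so that \<open>D / M * A = e / 6\<close>.\<close>
  define M where "M = 6 * D * A / e"
  have M: "M > 0" using A e D_ge_1 by (simp add: M_def)
  define E where "E = {x. V x < M}"
  have "{x \<in> space lebesgue. V x < M} \<in> sets lebesgue" by measurable
  then have [measurable]: "E \<in> sets lebesgue" by (simp add: E_def)
  let ?N = "CARD('n)"
  define C where "C k = real ?N ^ ?N * (real ?N / real k) powr s" for k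
  have C_nonneg: "C k \<ge> 0" for k by (simp add: C_def)
  \<comment> \<open>The grid is fixed here, fine enough for the averaging error. The factor
    \<open>D\<^sup>2\<close> comes from using the quasi-triangle inequality twice.\<close>
  have "(\<lambda>k. D\<^sup>2 * (C (Suc k) * A)) \<longlonglongrightarrow> D\<^sup>2 * (real ?N ^ ?N * 0 * A)"
    unfolding C_def using s
    by (intro tendsto_intros tendsto_zero_powrI[of _ _ "\<lambda>_. s" s] LIMSEQ_Suc[OF lim_const_over_n]) auto
  then have "\<forall>\<^sub>F k in sequentially. D\<^sup>2 * (C (Suc k) * A) < e / 6"
    using e by (intro order_tendstoD(2)) auto
  moreover have "\<forall>\<^sub>F k in sequentially. k \<ge> ?N" by (rule eventually_ge_at_top)
  ultimately have "\<forall>\<^sub>F k in sequentially. D\<^sup>2 * (C (Suc k) * A) < e / 6 \<and> k \<ge> ?N"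
    by eventually_elim simp
  then obtain k' where k': "D\<^sup>2 * (C (Suc k') * A) < e / 6" "k' \<ge> ?N"
    using eventually_happens'[OF sequentially_bot] by auto
  define k where "k = Suc k'"
  have k: "k > 0" "k \<ge> ?N" "D\<^sup>2 * (C k * A) \<le> e / 6" using k' by (auto simp: k_def)
  define P where "P n x = cell_avg k (U n) (cell_index k x)" for n x
  define g where "g x = lim (\<lambda>n. P n x)" for x
  have [measurable]: "P n \<in> borel_measurable lebesgue" for n unfolding P_def by measurable
  have [measurable]: "g \<in> borel_measurable lebesgue" unfolding g_def by measurable
  have Pg: "(\<lambda>n. P n x) \<longlonglongrightarrow> g x" for x
    using conv[of k'] by (simp add: g_def P_def k_def convergent_LIMSEQ_iff)
  \<comment> \<open>The averages and their limit are bounded by \<open>B\<close>, so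
    \<open>F (2 * B)\<close> times the indicator of the finite-measure set \<open>E\<close> is an
    integrable majorant.\<close>
  define B where "B = 1 + real k ^ ?N * (A / V0) / F 1"
  have PB: "\<bar>P n x\<bar> \<le> B" for n x
    unfolding P_def B_def using A V0 by (intro cell_avg_bound mass k) auto
  have gB: "\<bar>g x\<bar> \<le> B" for x
    using tendsto_rabs[OF Pg] by (rule LIMSEQ_le_const2) (auto simp: PB)
  have tail: "(\<lambda>n. \<integral>\<^sup>+x. ennreal (F (P n x - g x)) * indicator E x \<partial>lebesgue) \<longlonglongrightarrow>
      (\<integral>\<^sup>+x. 0 \<partial>(lebesgue :: (real ^ 'n) measure))"
  proof (rule nn_integral_dominated_convergence[where w = "\<lambda>x. ennreal (F (2 * B)) * indicator E x"])
    show "AE x in lebesgue. ennreal (F (P n x - g x)) * indicator E x \<le> ennreal (F (2 * B)) * indicator E x" for n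
    proof (rule AE_I2)
      fix x
      have "F (P n x - g x) \<le> F (2 * B)" using PB[of n x] gB[of x] by (intro mono) linarith
      then show "ennreal (F (P n x - g x)) * indicator E x \<le> ennreal (F (2 * B)) * indicator E x"
        by (intro mult_right_mono ennreal_leI) auto
    qed
    show "(\<integral>\<^sup>+x. ennreal (F (2 * B)) * indicator E x \<partial>lebesgue) < \<infinity>"
      using V1[OF M, folded E_def]
      by (simp add: nn_integral_cmult_indicator ennreal_mult_less_top del: emeasure_completion)
    show "AE x in lebesgue. (\<lambda>n. ennreal (F (P n x - g x)) * indicator E x) \<longlonglongrightarrow> 0"
    proof (rule AE_I2)
      fix x
      have "(\<lambda>n. ennreal (F (P n x - g x))) \<longlonglongrightarrow> ennreal (F (g x - g x))"
        by (intro tendsto_ennrealI isCont_tendsto_compose[OF isCont_F] tendsto_diff Pg tendsto_const)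
      then show "(\<lambda>n. ennreal (F (P n x - g x)) * indicator E x) \<longlonglongrightarrow> 0"
        by (cases "x \<in> E") auto
    qed
  qed measurable
  have "\<forall>\<^sub>F n in sequentially. (\<integral>\<^sup>+x. ennreal (F (P n x - g x)) * indicator E x \<partial>lebesgue) < ennreal (e / 6 / D\<^sup>2)"
    using tail e D_ge_1 by (intro order_tendstoD(2)) auto
  then obtain N where N: "\<And>n. n \<ge> N \<Longrightarrow>
      (\<integral>\<^sup>+x. ennreal (F (P n x - g x)) * indicator E x \<partial>lebesgue) < ennreal (e / 6 / D\<^sup>2)"
    by (auto simp: eventually_sequentially)
  \<comment> \<open>\<open>T n\<close> collects the three errors of \<open>U n\<close>. Off
    \<open>E\<close> the first term alone suffices, since \<open>V x / M \<ge> 1\<close> there; on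
    \<open>E\<close> the other two do.\<close>
  define T where "T n x = ennreal (D / M) * ennreal (V x * F (U n x)) +
    ennreal (D\<^sup>2) * ennreal (F (U n x - P n x)) +
    ennreal (D\<^sup>2) * (ennreal (F (P n x - g x)) * indicator E x)" for n x
  have [measurable]: "T n \<in> borel_measurable lebesgue" for n unfolding T_def by measurable
  have T: "(\<integral>\<^sup>+x. T n x \<partial>lebesgue) \<le> ennreal (e / 2)" if "n \<ge> N" for n
  proof -
    have "(\<integral>\<^sup>+x. ennreal (F (U n x - P n x)) \<partial>lebesgue) \<le>
        ennreal (C k) * (\<integral>\<^sup>+z. ennreal (F (holder_quot s (U n) z)) \<partial>frac_measure)"
      unfolding C_def P_def
      by (rule cell_avg_approx) (use k s mass[of n] in \<open>auto intro: le_less_trans\<close>)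
    also have "\<dots> \<le> ennreal (C k) * ennreal A" by (intro mult_left_mono frac) auto
    finally have approx: "(\<integral>\<^sup>+x. ennreal (F (U n x - P n x)) \<partial>lebesgue) \<le> ennreal (C k * A)"
      using A C_nonneg by (simp add: ennreal_mult)
    have "(\<integral>\<^sup>+x. T n x \<partial>lebesgue) = ennreal (D / M) * (\<integral>\<^sup>+x. ennreal (V x * F (U n x)) \<partial>lebesgue) +
        ennreal (D\<^sup>2) * (\<integral>\<^sup>+x. ennreal (F (U n x - P n x)) \<partial>lebesgue) +
        ennreal (D\<^sup>2) * (\<integral>\<^sup>+x. ennreal (F (P n x - g x)) * indicator E x \<partial>lebesgue)"
      unfolding T_def by (simp add: nn_integral_add nn_integral_cmult)
    also have "\<dots> \<le> ennreal (D / M) * ennreal A + ennreal (D\<^sup>2) * ennreal (C k * A) +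
        ennreal (D\<^sup>2) * ennreal (e / 6 / D\<^sup>2)"
      using N[OF that] by (intro add_mono mult_left_mono pot approx) auto
    also have "\<dots> = ennreal (D / M * A + D\<^sup>2 * (C k * A) + D\<^sup>2 * (e / 6 / D\<^sup>2))"
      using D_ge_1 M A e C_nonneg by (simp flip: ennreal_mult ennreal_plus)
    also have "\<dots> \<le> ennreal (e / 2)"
    proof (rule ennreal_leI)
      have "D / M * A = e / 6" "D\<^sup>2 * (e / 6 / D\<^sup>2) = e / 6" using D_ge_1 A e by (simp_all add: M_def)
      then have "D / M * A + D\<^sup>2 * (C k * A) + D\<^sup>2 * (e / 6 / D\<^sup>2) = e / 6 + D\<^sup>2 * (C k * A) + e / 6"
        by (simp only:)
      also have "\<dots> \<le> e / 2" using k(3) by linarith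
      finally show "D / M * A + D\<^sup>2 * (C k * A) + D\<^sup>2 * (e / 6 / D\<^sup>2) \<le> e / 2" .
    qed
    finally show ?thesis .
  qed
  have split: "ennreal (F (U i x - U j x)) \<le> T i x + T j x" for i j x
  proof (cases "x \<in> E")
    case True
    have "F (U n x - g x) \<le> D * (F (U n x - P n x) + F (P n x - g x))" for n
      using add_le[of "U n x - P n x" "P n x - g x"] by simp
    moreover have "F (U i x - U j x) \<le> D * (F (U i x - g x) + F (U j x - g x))"
      using diff_le[of "U i x - g x" "U j x - g x"] by simp
    ultimately have "F (U i x - U j x) \<le> D * (D * (F (U i x - P i x) + F (P i x - g x)) +
        D * (F (U j x - P j x) + F (P j x - g x)))"
      using D_ge_1 by (smt (verit) mult_left_mono)
    also have "\<dots> = (D\<^sup>2 * F (U i x - P i x) + D\<^sup>2 * F (P i x - g x)) +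
        (D\<^sup>2 * F (U j x - P j x) + D\<^sup>2 * F (P j x - g x))"
      by (simp add: power2_eq_square algebra_simps)
    finally have "ennreal (F (U i x - U j x)) \<le>
        (ennreal (D\<^sup>2) * ennreal (F (U i x - P i x)) + ennreal (D\<^sup>2) * ennreal (F (P i x - g x))) +
        (ennreal (D\<^sup>2) * ennreal (F (U j x - P j x)) + ennreal (D\<^sup>2) * ennreal (F (P j x - g x)))"
      by (simp flip: ennreal_mult ennreal_plus add: ennreal_leI)
    also have "\<dots> \<le> T i x + T j x"
      using True by (intro add_mono) (auto simp: T_def add.assoc)
    finally show ?thesis .
  next
    case False
    then have VM: "V x / M \<ge> 1" using M by (simp add: E_def)
    have "F (U n x) \<le> V x / M * F (U n x)" for n
      using mult_right_mono[OF VM nonneg[of "U n x"]] by simp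
    then have "D * (F (U i x) + F (U j x)) \<le> D * (V x / M * F (U i x) + V x / M * F (U j x))"
      using D_ge_1 by (intro mult_left_mono add_mono) auto
    with diff_le[of "U i x" "U j x"]
    have "F (U i x - U j x) \<le> D / M * (V x * F (U i x)) + D / M * (V x * F (U j x))"
      by (simp add: field_simps)
    moreover have "V x \<ge> 0" using V0(1) V0(2)[of x] by linarith
    ultimately have "ennreal (F (U i x - U j x)) \<le>
        ennreal (D / M) * ennreal (V x * F (U i x)) + ennreal (D / M) * ennreal (V x * F (U j x))"
      using D_ge_1 M by (simp flip: ennreal_mult ennreal_plus add: ennreal_leI)
    also have "\<dots> \<le> T i x + T j x"
      by (intro add_mono) (auto simp: T_def add.assoc)
    finally show ?thesis .
  qed
  have "(\<integral>\<^sup>+x. ennreal (F (U i x - U j x)) \<partial>lebesgue) \<le> ennreal e" if "i \<ge> N" "j \<ge> N" for i j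
  proof -
    have "(\<integral>\<^sup>+x. ennreal (F (U i x - U j x)) \<partial>lebesgue) \<le> (\<integral>\<^sup>+x. T i x + T j x \<partial>lebesgue)"
      by (intro nn_integral_mono split)
    also have "\<dots> = (\<integral>\<^sup>+x. T i x \<partial>lebesgue) + (\<integral>\<^sup>+x. T j x \<partial>lebesgue)"
      by (rule nn_integral_add) auto
    also have "\<dots> \<le> ennreal (e / 2) + ennreal (e / 2)" by (intro add_mono T that)
    finally show ?thesis using e by (simp flip: ennreal_plus)
  qed
  then show ?thesis by blast
qed

lemma compact_embedding_X:
  fixes V :: "real ^ 'n \<Rightarrow> real"
  assumes s: "s > 0"
    and V [measurable]: "V \<in> borel_measurable lebesgue" and V0: "V0 > 0" "\<And>x. V x \<ge> V0"
    and V1: "\<And>M. M > 0 \<Longrightarrow> emeasure lebesgue {x. V x < M} < \<infinity>"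
  shows "compact_embedding (X_space s F V) (X_norm s F V) (orlicz_space F) (orlicz_norm F)"
  unfolding compact_embedding_def
proof (intro conjI allI impI)
  have Vnn: "V x \<ge> 0" for x using V0(1) V0(2)[of x] by linarith
  show "X_space s F V \<subseteq> orlicz_space F" by (auto simp: X_space_iff orlicz_space_iff)
  \<comment> \<open>\<open>V0\<close> may exceed 1, whereas the scaling by convexity requires a
    factor at most 1.\<close>
  define c where "c = min 1 V0"
  have c: "0 < c" "c \<le> 1" "\<And>x. V x \<ge> c" using V0 by (auto simp: c_def min.coboundedI2)
  have "orlicz_norm F u \<le> 1 / c * X_norm s F V u" if "u \<in> X_space s F V" for u
  proof -
    from that have u: "u \<in> borel_measurable lebesgue"
      "(\<integral>\<^sup>+z. ennreal (F (holder_quot s u z)) \<partial>frac_measure) < \<infinity>"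
      "(\<integral>\<^sup>+x. ennreal (V x * F (u x)) \<partial>lebesgue) < \<infinity>"
      by (auto simp: X_space_iff)
    have "orlicz_norm F u \<le> 1 / c * weighted_norm F V u"
      by (rule orlicz_norm_le_weighted_norm[OF u(1) V c u(3)])
    also have "\<dots> \<le> 1 / c * X_norm s F V u"
      using c frac_seminorm_nonneg[OF u(1,2)] by (intro mult_left_mono) (auto simp: X_norm_def)
    finally show ?thesis .
  qed
  then show "\<exists>C. \<forall>u\<in>X_space s F V. orlicz_norm F u \<le> C * X_norm s F V u" by blast
  fix U :: "nat \<Rightarrow> real ^ 'n \<Rightarrow> real"
  assume asm: "(\<forall>n. U n \<in> X_space s F V) \<and> (\<exists>K. \<forall>n. X_norm s F V (U n) \<le> K)"
  then obtain K where Uin: "\<And>n. U n \<in> X_space s F V" and K: "\<And>n. X_norm s F V (U n) \<le> K"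
    by blast
  from X_bounded_imp_modular_bounded[of V U s K, OF V Vnn Uin K]
  obtain A where A: "A > 0"
    and frac: "\<And>n. (\<integral>\<^sup>+z. ennreal (F (holder_quot s (U n) z)) \<partial>frac_measure) \<le> ennreal A"
    and pot: "\<And>n. (\<integral>\<^sup>+x. ennreal (V x * F (U n x)) \<partial>lebesgue) \<le> ennreal A"
    by auto
  have meas [measurable]: "U n \<in> borel_measurable lebesgue"
    and mass: "(\<integral>\<^sup>+x. ennreal (F (U n x)) \<partial>lebesgue) < \<infinity>" for n
    using Uin[of n] by (auto simp: X_space_iff)
  \<comment> \<open>The pairs of grid size and cell index are countable, so one diagonal subsequence
    serves all grids at once.\<close>
  have "\<exists>B. \<forall>n. \<bar>cell_avg (Suc (fst p)) (U n) (snd p)\<bar> \<le> B" for p :: "nat \<times> (int ^ 'n)"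
  proof -
    note modular_le_of_weighted_modular_le[OF meas V V0 less_imp_le[OF A] pot]
    from cell_avg_bound[where k = "Suc (fst p)" and z = "snd p", OF zero_less_Suc meas this] show ?thesis
      using A V0(1) by (intro exI allI) simp
  qed
  then obtain r where r: "strict_mono r"
    and conv: "\<And>p. convergent (\<lambda>n. cell_avg (Suc (fst p)) (U (r n)) (snd p :: int ^ 'n))"
    using bounded_countable_convergent_subsequence[of "\<lambda>n p. cell_avg (Suc (fst p)) (U n) (snd p)"]
    by blast
  have conv': "convergent (\<lambda>n. cell_avg (Suc k) (U (r n)) z)" for k z
    using conv[of "(k, z)"] by simp
  have "\<exists>r' u. strict_mono r' \<and> u \<in> borel_measurable lebesgue \<and>
      (\<lambda>n. \<integral>\<^sup>+x. ennreal (F (U (r (r' n)) x - u x)) \<partial>lebesgue) \<longlonglongrightarrow> 0"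
    by (rule modular_complete[of "\<lambda>n. U (r n)"])
      (rule meas, rule X_bounded_modular_Cauchy[OF s V V0 V1 meas A frac pot conv'])
  then obtain r' u where r': "strict_mono r'" and u [measurable]: "u \<in> borel_measurable lebesgue"
    and lim: "(\<lambda>n. \<integral>\<^sup>+x. ennreal (F (U (r (r' n)) x - u x)) \<partial>lebesgue) \<longlonglongrightarrow> 0" by blast
  \<comment> \<open>A single \<open>n\<close> with finite modular of the difference puts
    \<open>u\<close> in the space, since \<open>u\<close> equals \<open>U (r (r' n))\<close> minus
    that difference.\<close>
  have "\<forall>\<^sub>F n in sequentially. (\<integral>\<^sup>+x. ennreal (F (U (r (r' n)) x - u x)) \<partial>lebesgue) < 1"
    using lim by (rule order_tendstoD) simp
  then obtain n where n: "(\<integral>\<^sup>+x. ennreal (F (U (r (r' n)) x - u x)) \<partial>lebesgue) < 1"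
    using eventually_happens'[OF sequentially_bot] by auto
  have "(\<integral>\<^sup>+x. ennreal (F (U (r (r' n)) x - (U (r (r' n)) x - u x))) \<partial>lebesgue) \<le>
      ennreal D * ((\<integral>\<^sup>+x. ennreal (F (U (r (r' n)) x)) \<partial>lebesgue) +
      (\<integral>\<^sup>+x. ennreal (F (U (r (r' n)) x - u x)) \<partial>lebesgue))"
    by (rule modular_diff_le) auto
  also have "\<dots> < \<infinity>"
    using mass[of "r (r' n)"] less_trans[OF n ennreal_one_less_top] by (simp add: ennreal_mult_less_top)
  finally have "u \<in> orlicz_space F" by (simp add: orlicz_space_iff u)
  moreover have "(\<lambda>n. orlicz_norm F (\<lambda>x. U ((r \<circ> r') n) x - u x)) \<longlonglongrightarrow> 0"
    using luxemburg_tendsto_0[of "\<lambda>n x. U (r (r' n)) x - u x" lebesgue] lim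
    by (simp add: orlicz_norm_def)
  ultimately show "\<exists>u\<in>orlicz_space F. \<exists>r. strict_mono r \<and>
      (\<lambda>n. orlicz_norm F (\<lambda>x. U (r n) x - u x)) \<longlonglongrightarrow> 0"
    using strict_mono_o[OF r r'] by blast
qed

end

section \<open>The Young function generated by phi\<close>

lemma Phi_has_real_derivative:
  assumes "continuous_on UNIV \<phi>"
  shows "(Phi \<phi> has_real_derivative t * \<phi> t) (at t)"
proof -
  \<comment> \<open>The interval from \<open>- a\<close> to \<open>a\<close> contains 0 and has
    \<open>t\<close> in its interior, so the derivative within it is the full derivative.\<close>
  define a where "a = \<bar>t\<bar> + 1"
  have "((\<lambda>t. LBINT \<tau>=ereal 0..ereal t. \<tau> * \<phi> \<tau>) has_vector_derivative t * \<phi> t) (at t within {-a..a})"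
    by (rule interval_integral_FTC2)
       (auto simp: a_def intro!: continuous_intros continuous_on_subset[OF assms])
  moreover have "at t within {-a..a} = at t" by (rule at_within_Icc_at) (auto simp: a_def)
  ultimately show ?thesis
    unfolding Phi_def[abs_def] has_real_derivative_iff_has_vector_derivative by simp
qed

text \<open>The derivative \<open>f\<close> of \<open>Phi \<phi>\<close> is odd and increasing,
  whence convexity. The bound \<open>upper\<close> says that the logarithmic derivative is at most
  \<open>m / t\<close>, so \<open>Phi \<phi> t * t powr (- m)\<close> is nonincreasing on the
  positive half-line; comparing \<open>t\<close> with \<open>2 * t\<close> gives doubling.\<close>

lemma doubling_young_Phi:
  assumes cont: "continuous_on UNIV \<phi>"
    and even: "\<And>t. Phi \<phi> (- t) = Phi \<phi> t"
    and incr: "strict_mono_on {0<..} (\<lambda>t. t * \<phi> t)"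
    and upper: "\<And>t. t > 0 \<Longrightarrow> t\<^sup>2 * \<phi> t / Phi \<phi> t \<le> m"
  shows "doubling_young (Phi \<phi>) (2 powr m)"
proof
  define f where "f t = t * \<phi> t" for t
  have deriv: "(Phi \<phi> has_real_derivative f t) (at t)" for t
    unfolding f_def by (rule Phi_has_real_derivative[OF cont])
  show zero: "Phi \<phi> 0 = 0" by (simp add: Phi_def flip: zero_ereal_def)
  show "Phi \<phi> (- t) = Phi \<phi> t" for t by (rule even)
  \<comment> \<open>Differentiate the identity
    \<open>Phi \<phi> (- t) = Phi \<phi> t\<close>.\<close>
  have odd: "f (- t) = - f t" for t
  proof -
    have "((\<lambda>t. Phi \<phi> (- t)) has_real_derivative f (- t) * (- 1)) (at t)"
      by (rule DERIV_chain2[OF deriv]) (auto intro!: derivative_eq_intros)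
    then have "(Phi \<phi> has_real_derivative - f (- t)) (at t)" by (simp add: even)
    from DERIV_unique[OF this deriv] show ?thesis by simp
  qed
  \<comment> \<open>Monotonicity is known only on the open half-line, so \<open>f 0 = 0\<close> is
    reached as a limit from the right; comparison with \<open>t / 2\<close> then makes the
    inequality strict.\<close>
  have f_nonneg: "f t \<ge> 0" if "t > 0" for t
  proof (rule tendsto_upperbound)
    have "continuous_on UNIV f" unfolding f_def by (intro continuous_intros cont)
    then have "isCont f 0" by (simp add: continuous_on_eq_continuous_at)
    then have "(f \<longlongrightarrow> f 0) (at_right 0)"
      unfolding isCont_def by (rule filterlim_mono) (auto intro: at_le)
    then show "(f \<longlongrightarrow> 0) (at_right 0)" by (simp add: f_def)
    show "\<forall>\<^sub>F x in at_right 0. f x \<le> f t"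
      using that strict_mono_onD[OF incr] unfolding f_def
      by (auto simp: eventually_at_right intro!: exI[of _ t] less_imp_le)
  qed simp
  have f_pos: "f t > 0" if "t > 0" for t
  proof -
    have "f (t / 2) < f t"
      unfolding f_def using strict_mono_onD[OF incr, of "t / 2" t] that by simp
    then show ?thesis using f_nonneg[of "t / 2"] that by simp
  qed
  have f_mono: "f x \<le> f y" if "x \<le> y" for x y
  proof -
    have 1: "f x \<le> f y" if "0 < x" "x \<le> y" for x y
      using strict_mono_onD[OF incr, of x y] that by (cases "x = y") (auto simp: f_def)
    have f0: "f 0 = 0" by (simp add: f_def)
    consider "0 < x" | "x \<le> 0" "0 \<le> y" | "y < 0" using that by linarith
    then show ?thesis
    proof cases
      case 2
      have "f x \<le> 0" using odd[of x] f_pos[of "- x"] f0 2 by (cases "x = 0") auto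
      moreover have "0 \<le> f y" using f_pos[of y] f0 2 by (cases "y = 0") auto
      ultimately show ?thesis by simp
    next
      case 3
      then show ?thesis using 1[of "- y" "- x"] odd that by simp
    qed (use 1 that in auto)
  qed
  show "convex_on UNIV (Phi \<phi>)"
    by (rule convex_on_realI[where f' = f]) (auto intro: deriv f_mono)
  show pos: "Phi \<phi> t > 0" if "t > 0" for t
  proof -
    have "Phi \<phi> 0 < Phi \<phi> t"
    proof (rule DERIV_pos_imp_increasing_open[OF that])
      show "\<exists>y. (Phi \<phi> has_real_derivative y) (at x) \<and> 0 < y" if "0 < x" for x
        using deriv f_pos that by blast
      show "continuous_on {0..t} (Phi \<phi>)"
        using deriv by (intro continuous_at_imp_continuous_on) (auto intro: DERIV_isCont)
    qed
    then show ?thesis by (simp add: zero)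
  qed
  have doubling_pos: "Phi \<phi> (2 * t) \<le> 2 powr m * Phi \<phi> t" if t: "t > 0" for t
  proof -
    have "Phi \<phi> (2 * t) * (2 * t) powr (- m) \<le> Phi \<phi> t * t powr (- m)"
    proof (rule DERIV_nonpos_imp_nonincreasing[where f = "\<lambda>x. Phi \<phi> x * x powr (- m)"])
      fix x assume "t \<le> x"
      then have x: "x > 0" using t by simp
      \<comment> \<open>This is \<open>upper\<close> with the positive denominator cleared; it gives
        the sign of the derivative of the quotient.\<close>
      have "x * f x \<le> m * Phi \<phi> x"
        using upper[OF x] pos[OF x] by (simp add: f_def power2_eq_square field_simps)
      then have "x powr (- m - 1) * (x * f x - m * Phi \<phi> x) \<le> 0"
        by (intro mult_nonneg_nonpos) auto
      moreover have "((\<lambda>x. Phi \<phi> x * x powr (- m)) has_real_derivative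
          x powr (- m - 1) * (x * f x - m * Phi \<phi> x)) (at x)"
      proof -
        have "x powr (- m) = x powr (- m - 1) * x"
          using x powr_add[of x "- m - 1" 1] by simp
        then show ?thesis
          using x by (auto intro!: derivative_eq_intros deriv simp: algebra_simps)
      qed
      ultimately show "\<exists>y. ((\<lambda>x. Phi \<phi> x * x powr (- m)) has_real_derivative y) (at x) \<and> y \<le> 0"
        by blast
    qed (use t in simp)
    also have "(2 * t) powr (- m) = 2 powr (- m) * t powr (- m)" using t by (simp add: powr_mult)
    finally show ?thesis using t by (simp add: powr_minus field_simps)
  qed
  show "Phi \<phi> (2 * t) \<le> 2 powr m * Phi \<phi> t" for t
    using doubling_pos[of t] doubling_pos[of "- t"] even[of t] even[of "2 * t"] zero
    by (cases t "0::real" rule: linorder_cases) auto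
qed

theorem theorem1p1:
  fixes \<phi> :: "real \<Rightarrow> real" and V :: "real ^ 'n \<Rightarrow> real" and s l m V0 :: real
  assumes s: "0 < s" "s < 1" "real CARD('n) > 2 * s"
    and phi_C1: "\<phi> C1_differentiable_on UNIV"
    and Phi_even: "\<And>t. Phi \<phi> (- t) = Phi \<phi> t"
    and phi1: "((\<lambda>t. t * \<phi> t) \<longlongrightarrow> 0) (at 0)"
              "filterlim (\<lambda>t. t * \<phi> t) at_top at_top"
    and phi2: "strict_mono_on {0<..} (\<lambda>t. t * \<phi> t)"
    and phi3: "1 < l" "l < real CARD('n)" "1 < m" "m < real CARD('n)"
              "\<And>t. t > 0 \<Longrightarrow> l \<le> t\<^sup>2 * \<phi> t / Phi \<phi> t"
              "\<And>t. t > 0 \<Longrightarrow> t\<^sup>2 * \<phi> t / Phi \<phi> t \<le> m"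
              "m < l * real CARD('n) / (real CARD('n) - l)"
    and V_meas: "V \<in> borel_measurable lebesgue"
    and V0: "V0 > 0" "\<And>x. V x \<ge> V0"
    and V1: "\<And>M. M > 0 \<Longrightarrow> emeasure lebesgue {x. V x < M} < \<infinity>"
  shows "compact_embedding
           (X_space s (Phi \<phi>) V) (X_norm s (Phi \<phi>) V)
           (orlicz_space (Phi \<phi>)) (orlicz_norm (Phi \<phi>))"
proof -
  interpret doubling_young "Phi \<phi>" "2 powr m"
    by (rule doubling_young_Phi[OF C1_differentiable_imp_continuous_on[OF phi_C1] Phi_even phi2 phi3(6)])
  show ?thesis by (rule compact_embedding_X[OF s(1) V_meas V0 V1])
qed

end
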